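(* Let $b$ be a prime, let $s,m,\alpha,d\in\mathbb{N}$ with $1<d\le\alpha$, and let $\boldsymbol{\gamma}=(\gamma_v)_{v\subseteq\{1:s\}}$ be non-negative real weights. Suppose $p\in\mathbb{F}_b[x]$ is irreducible with $\deg(p)=m$ and $q\in\mathcal{R}_m$ minimizes $B_{d,\boldsymbol{\gamma},(2)}(\psi_{ds}(\tilde q),p)$ as a function of $\tilde q\in\mathcal{R}_m$ (Korobov construction). Then for any real $\lambda$ with $1/\min(\alpha,d)<\lambda\le1$ we have $$B_{d,\boldsymbol{\gamma},(2)}(\psi_{ds}(q),p)\le\frac{(ds)^{1/\lambda}}{(b^m-1)^{1/\lambda}}\left[\sum_{\emptyset\ne v\subseteq\{1:s\}}\gamma_v^\lambda H_{d,\lambda,(2)}^{|v|}\right]^{1/\lambda},$$ where $$H_{d,\lambda,(2)}=-1+\prod_{l=1}^d\left[1+b^{\lambda(d-l)}\tilde H_{d,\lambda,(2)}\right],\qquad\tilde H_{d,\lambda,(2)}=\frac{b-1}{b^{\lambda\min(\alpha,d)}-b}.$$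
   Context: $\mathbb{N}$ is the set of positive integers, $\mathbb{N}_0=\mathbb{N}\cup\{0\}$, $\{a:c\}=\{a,\ldots,c\}$; $\mathbb{F}_b$ is the field with $b$ elements, identified with $\{0,\ldots,b-1\}$; $\mathcal{R}_m=\{q\in\mathbb{F}_b[x]:\deg(q)<m,\ q\ne0\}$. For $q\in\mathcal{R}_m$, $\psi_{ds}(q)=(1,q,q^2,\ldots,q^{ds-1})\pmod p$, each component reduced modulo $p$ to a polynomial of degree less than $m$. For $k\in\mathbb{N}_0$ with $b$-adic expansion $k=\kappa_0+\kappa_1b+\cdots$, $\mathrm{tr}_m(k)=\kappa_0+\kappa_1x+\cdots+\kappa_{m-1}x^{m-1}\in\mathbb{F}_b[x]$. For $\boldsymbol{q}=(q_1,\ldots,q_{ds})\in(\mathbb{F}_b[x])^{ds}$, $D^\perp_{\boldsymbol{q},p}=\{\boldsymbol{k}\in\mathbb{N}_0^{ds}:\sum_{j=1}^{ds}\mathrm{tr}_m(k_j)q_j\equiv0\pmod p\}$. For $k\in\mathbb{N}$, $\mu_1(k)=a$ iff $b^{a-1}\le k<b^a$. For $1\le j\le ds$, $\tilde r_{d,j,(2)}(k)=b^{-d\mu_1(k)-j+d\lceil j/d\rceil}$ for $k\ge1$ and $\tilde r_{d,j,(2)}(0)=1$; $\tilde r_{d,u,(2)}(\boldsymbol{k}_u)=\prod_{j\in u}\tilde r_{d,j,(2)}(k_j)$. For $u\subseteq\{1:ds\}$, $w(u)$ is the set of $1\le j\le s$ with $u\cap\{(j-1)d+1:jd\}\ne\emptyset$.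 The quality criterion is $$B_{d,\boldsymbol{\gamma},(2)}(\boldsymbol{q},p)=\sum_{\emptyset\ne u\subseteq\{1:ds\}}\gamma_{w(u)}\sum_{\substack{\boldsymbol{k}_u\in\mathbb{N}^{|u|}\\(\boldsymbol{k}_u,\boldsymbol{0})\in D^\perp_{\boldsymbol{q},p}}}\tilde r_{d,u,(2)}(\boldsymbol{k}_u),$$ where $(\boldsymbol{k}_u,\boldsymbol{0})\in\mathbb{N}_0^{ds}$ has components $0$ outside $u$. (For $d\le\alpha$ it is an upper bound on the worst-case integration error, in the weighted Walsh space of smoothness $\alpha$ with weights $\boldsymbol{\gamma}$, of the interlaced polynomial lattice rule of order $d$ with generating vector $\boldsymbol{q}$ and modulus $p$.) *)

theory Defs
  imports
    "HOL-Analysis.Analysis"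
    "HOL-Computational_Algebra.Polynomial"
    "HOL-Number_Theory.Cong"
begin

text \<open>
  The field with \<open>b\<close> elements is an arbitrary type \<open>'a\<close> of class \<open>field\<close> with \<open>CARD('a) = b\<close>,
  where \<open>b\<close> is prime.  It is identified with \<open>{0..<b}\<close> through \<open>of_nat\<close>:
\<close>

lemma bij_betw_of_nat_prime_field:
  assumes "prime b" and "CARD('a::field) = b"
  shows "bij_betw (of_nat :: nat \<Rightarrow> 'a) {0..<b} UNIV"
proof -
  have "b > 0" using assms(1) by (simp add: prime_gt_0_nat)
  hence fin: "finite (UNIV :: 'a set)"
    using assms(2) by (metis card.infinite less_irrefl)
  have "bij (\<lambda>x :: 'a. x + 1)"
    by (rule bij_betw_byWitness[where f' = "\<lambda>x. x - 1"]) auto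
  hence "(\<Sum>x\<in>UNIV. x + 1 :: 'a) = (\<Sum>x\<in>UNIV. x)"
    by (rule sum.reindex_bij_betw)
  hence "of_nat b = (0 :: 'a)" by (simp add: sum.distrib assms(2))
  hence "CHAR('a) dvd b" by (simp add: of_nat_eq_0_iff_char_dvd)
  hence char: "CHAR('a) = b"
    using assms(1) CHAR_not_1'[where 'a = 'a] by (auto simp: prime_nat_iff)
  have inj: "inj_on (of_nat :: nat \<Rightarrow> 'a) {0..<b}"
    by (rule inj_onI) (auto simp: of_nat_eq_iff_cong_CHAR char cong_def)
  have "of_nat ` {0..<b} = (UNIV :: 'a set)"
    by (rule card_subset_eq[OF fin]) (simp_all add: card_image[OF inj] assms(2))
  with inj show ?thesis by (simp add: bij_betw_def)
qed

definition R_polys :: "nat \<Rightarrow> 'a::field poly set" where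
  "R_polys m = {q. q \<noteq> 0 \<and> degree q < m}"

text \<open>
  A vector with \<open>n\<close> components is a function on the index set \<open>{1..n}\<close> (values outside of it are
  irrelevant, or \<open>undefined\<close> when the function is taken from an extensional function space).
\<close>

definition psi :: "'a::field poly \<Rightarrow> 'a poly \<Rightarrow> nat \<Rightarrow> 'a poly" where
  "psi p q j = q ^ (j - 1) mod p"

definition tr :: "nat \<Rightarrow> nat \<Rightarrow> nat \<Rightarrow> 'a::field poly" where
  "tr b m k = (\<Sum>i<m. monom (of_nat (k div b ^ i mod b)) i)"

definition dual_net ::
    "nat \<Rightarrow> nat \<Rightarrow> nat \<Rightarrow> (nat \<Rightarrow> 'a::field poly) \<Rightarrow> 'a poly \<Rightarrow> (nat \<Rightarrow> nat) set" where
  "dual_net b m n q p =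
     {k \<in> {1..n} \<rightarrow>\<^sub>E UNIV. [(\<Sum>j = 1..n. tr b m (k j) * q j) = 0] (mod p)}"

definition mu1 :: "nat \<Rightarrow> nat \<Rightarrow> nat" where
  "mu1 b k = (THE a. a \<ge> 1 \<and> b ^ (a - 1) \<le> k \<and> k < b ^ a)"

definition r_tilde :: "nat \<Rightarrow> nat \<Rightarrow> nat \<Rightarrow> nat \<Rightarrow> real" where
  "r_tilde b d j k =
     (if k = 0 then 1
      else real b powi (- int d * int (mu1 b k) - int j + int d * \<lceil>real j / real d\<rceil>))"

definition r_tilde_prod :: "nat \<Rightarrow> nat \<Rightarrow> nat set \<Rightarrow> (nat \<Rightarrow> nat) \<Rightarrow> real" where
  "r_tilde_prod b d u k = (\<Prod>j\<in>u. r_tilde b d j (k j))"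

definition w_set :: "nat \<Rightarrow> nat \<Rightarrow> nat set \<Rightarrow> nat set" where
  "w_set d s u = {j \<in> {1..s}. u \<inter> {(j - 1) * d + 1..j * d} \<noteq> {}}"

definition zero_ext :: "nat \<Rightarrow> nat set \<Rightarrow> (nat \<Rightarrow> nat) \<Rightarrow> nat \<Rightarrow> nat" where
  "zero_ext n u k = (\<lambda>j\<in>{1..n}. if j \<in> u then k j else 0)"

text \<open>
  In \<open>B_crit\<close>, the vectors with positive components indexed by \<open>u\<close> are the elements of
  \<open>u \<rightarrow>\<^sub>E {1..}\<close>, and \<open>zero_ext\<close> turns them into vectors with \<open>d * s\<close> components.
\<close>

definition B_crit ::
    "nat \<Rightarrow> nat \<Rightarrow> nat \<Rightarrow> nat \<Rightarrow> (nat set \<Rightarrow> real) \<Rightarrow> (nat \<Rightarrow> 'a::field poly) \<Rightarrow> 'a poly \<Rightarrow> real" where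
  "B_crit b m s d \<gamma> q p =
     (\<Sum>u | u \<noteq> {} \<and> u \<subseteq> {1..d * s}. \<gamma> (w_set d s u) *
        (\<Sum>\<^sub>\<infinity>k | k \<in> u \<rightarrow>\<^sub>E {1..} \<and> zero_ext (d * s) u k \<in> dual_net b m (d * s) q p.
           r_tilde_prod b d u k))"

definition H_tilde :: "nat \<Rightarrow> nat \<Rightarrow> nat \<Rightarrow> real \<Rightarrow> real" where
  "H_tilde b \<alpha> d lam = (real b - 1) / (real b powr (lam * real (min \<alpha> d)) - real b)"

definition H_const :: "nat \<Rightarrow> nat \<Rightarrow> nat \<Rightarrow> real \<Rightarrow> real" where
  "H_const b \<alpha> d lam =
     - 1 + (\<Prod>l = 1..d. 1 + real b powr (lam * (real d - real l)) * H_tilde b \<alpha> d lam)"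

text \<open>
  \<open>infsum\<close> is \<open>0\<close> for families that are not summable; \<open>r_tilde_prod_summable\<close> below shows that
  it is never used as such a default in \<open>B_crit\<close> when \<open>b\<close> and \<open>d\<close> are at least 2.
\<close>

lemma mu1_unique:
  fixes a a' b k :: nat
  assumes "b \<ge> 2" "b ^ (a - 1) \<le> k" "k < b ^ a" "b ^ (a' - 1) \<le> k" "k < b ^ a'"
  shows "a = a'"
proof -
  have b: "b > 1" using assms(1) by simp
  have "a - 1 < a'"
    by (rule power_less_imp_less_exp[OF b le_less_trans[OF assms(2,5)]])
  moreover have "a' - 1 < a"
    by (rule power_less_imp_less_exp[OF b le_less_trans[OF assms(4,3)]])
  ultimately show ?thesis by linarith
qed

lemma mu1_eq_iff:
  assumes "b \<ge> 2" "k \<ge> 1"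
  shows "mu1 b k = a \<longleftrightarrow> a \<ge> 1 \<and> b ^ (a - 1) \<le> k \<and> k < b ^ a"
proof -
  have "\<exists>a. a \<ge> 1 \<and> b ^ (a - 1) \<le> k \<and> k < b ^ a"
  proof -
    have "k < b ^ k" using assms(1) by (simp add: less_exp power_gt_expt)
    hence ex: "\<exists>a. k < b ^ a" by blast
    define a where "a = (LEAST a. k < b ^ a)"
    have 1: "k < b ^ a" unfolding a_def using LeastI_ex[OF ex] .
    have 2: "a \<noteq> 0" using 1 assms(2) by (cases a) auto
    have "\<not> k < b ^ (a - 1)"
      using not_less_Least[of "a - 1" "\<lambda>a. k < b ^ a"] 2 unfolding a_def[symmetric] by simp
    with 1 2 show ?thesis by (intro exI[of _ a]) auto
  qed
  then obtain c where c: "c \<ge> 1" "b ^ (c - 1) \<le> k" "k < b ^ c" by blast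
  have *: "mu1 b k = c" unfolding mu1_def
  proof (rule the_equality)
    fix a assume "a \<ge> 1 \<and> b ^ (a - 1) \<le> k \<and> k < b ^ a"
    thus "a = c" using mu1_unique[OF assms(1) _ _ c(2,3), of a] by blast
  qed (use c in blast)
  show ?thesis
  proof
    assume "mu1 b k = a"
    thus "a \<ge> 1 \<and> b ^ (a - 1) \<le> k \<and> k < b ^ a" using * c by blast
  next
    assume "a \<ge> 1 \<and> b ^ (a - 1) \<le> k \<and> k < b ^ a"
    hence "a = c" using mu1_unique[OF assms(1) _ _ c(2,3), of a] by blast
    with * show "mu1 b k = a" by simp
  qed
qed

lemma r_tilde_nonneg: "r_tilde b d j k \<ge> 0"
  by (simp add: r_tilde_def)

lemma r_tilde_le:
  assumes b: "b \<ge> 2" and d: "d \<ge> 2" and k: "k \<ge> 1"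
  shows "r_tilde b d j k \<le> real b powi (int d * \<lceil>real j / real d\<rceil> - int j) * (1 / real k ^ 2)"
proof -
  define a where "a = mu1 b k"
  have kb: "k < b ^ a" using mu1_eq_iff[OF b k] a_def by blast
  have "real k ^ 2 \<le> real k ^ d" using d k by (intro power_increasing) auto
  also have "\<dots> \<le> real (b ^ a) ^ d" using kb by (intro power_mono) auto
  finally have le: "1 / real (b ^ a) ^ d \<le> 1 / real k ^ 2"
    using b k by (intro divide_left_mono) auto
  have eq: "real b powi (- (int d * int a)) = 1 / real (b ^ a) ^ d"
  proof -
    have "int d * int a = int (a * d)" by simp
    thus ?thesis by (simp only: power_int_minus power_int_of_nat power_mult of_nat_power divide_inverse mult_1_left)
  qed
  have split: "- int d * int a - int j + int d * \<lceil>real j / real d\<rceil>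
      = (int d * \<lceil>real j / real d\<rceil> - int j) + (- (int d * int a))" by simp
  have "r_tilde b d j k = real b powi (int d * \<lceil>real j / real d\<rceil> - int j)
      * real b powi (- (int d * int a))"
    using k b unfolding r_tilde_def a_def[symmetric] split by (subst power_int_add) auto
  thus ?thesis unfolding eq by (simp only:) (rule mult_left_mono[OF le], simp)
qed

lemma r_tilde_summable:
  assumes "b \<ge> 2" "d \<ge> 2"
  shows "r_tilde b d j summable_on {1..}"
proof -
  have "summable (\<lambda>k. 1 / real k ^ 2)"
    using inverse_power_summable[of 2, where 'a = real] by (simp add: field_simps)
  hence "(\<lambda>k. 1 / real k ^ 2) summable_on UNIV"
    by (subst summable_on_UNIV_nonneg_real_iff) auto
  hence "(\<lambda>k. 1 / real k ^ 2) summable_on {1..}"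
    by (rule summable_on_subset_banach) simp
  hence "(\<lambda>k. real b powi (int d * \<lceil>real j / real d\<rceil> - int j) * (1 / real k ^ 2)) summable_on {1..}"
    by (rule summable_on_cmult_right)
  thus ?thesis
    by (rule summable_on_comparison_test) (use r_tilde_le[OF assms] r_tilde_nonneg in auto)
qed

lemma r_tilde_prod_summable:
  assumes "b \<ge> 2" "d \<ge> 2" "finite u"
  shows "r_tilde_prod b d u summable_on {k. k \<in> u \<rightarrow>\<^sub>E {1..} \<and> P k}"
proof -
  have "Infinite_Set_Sum.abs_summable_on (\<lambda>k. \<Prod>j\<in>u. r_tilde b d j (k j)) (u \<rightarrow>\<^sub>E {1..})"
  proof (rule abs_summable_on_prod_PiE)
    fix j
    show "Infinite_Set_Sum.abs_summable_on (r_tilde b d j) {1..}"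
      using r_tilde_summable[OF assms(1,2), of j]
      unfolding abs_summable_equivalent[symmetric] real_norm_def abs_of_nonneg[OF r_tilde_nonneg] .
  qed (use assms in auto)
  hence "r_tilde_prod b d u summable_on (u \<rightarrow>\<^sub>E {1..})"
    unfolding r_tilde_prod_def
    unfolding abs_summable_equivalent[symmetric] by (rule abs_summable_summable)
  thus ?thesis by (rule summable_on_subset_banach) auto
qed

end

theory Submission
  imports Defs "HOL-Computational_Algebra.Polynomial_Factorial"
begin

text \<open>
  Since \<open>x \<mapsto> x\<^sup>\<lambda>\<close> is subadditive, the \<open>\<lambda>\<close>-th power of the criterion is at most the same sum with all
  its terms raised to the power \<open>\<lambda>\<close>, and the minimum over \<open>q\<close> is at most the average over the
  \<open>b\<^sup>m - 1\<close> candidates.  After exchanging sums, a vector \<open>k\<close> is weighted by the number of \<open>q\<close> that are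
  roots of \<open>\<Sum>\<^sub>j tr(k\<^sub>j) X\<^bsup>j-1\<^esup>\<close> modulo the prime \<open>p\<close>.  This is at most \<open>ds - 1\<close>, unless \<open>b\<^sup>m\<close> divides
  every \<open>k\<^sub>j\<close>; the vectors of the latter kind contribute \<open>b\<^sup>m - 1\<close> each, but their total weight is smaller by
  the factor \<open>b\<^bsup>-\<lambda>dm|u|\<^esup> \<le> b\<^bsup>-m\<^esup>\<close>.  Together this gives the factor \<open>ds\<close>, and the remaining
  unrestricted sums factorize, first over the components and then over the blocks of length \<open>d\<close>.
\<close>

section \<open>Subadditivity of powers with exponent at most one\<close>

text \<open>Factor each term as \<open>f x powr lam * f x powr (1 - lam)\<close> and bound the
  second factor uniformly by a power of the whole sum \<open>S\<close>. Summing gives at most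
  \<open>S * c\<close>, which is \<open>S powr (1 / lam)\<close>.\<close>

lemma infsum_powr_le:
  fixes f :: "'i \<Rightarrow> real"
  assumes nonneg: "\<And>x. x \<in> A \<Longrightarrow> f x \<ge> 0" and lam: "0 < lam" "lam \<le> 1"
    and summable: "(\<lambda>x. f x powr lam) summable_on A"
  shows "infsum f A powr lam \<le> (\<Sum>\<^sub>\<infinity>x\<in>A. f x powr lam)"
proof -
  define S where "S = (\<Sum>\<^sub>\<infinity>x\<in>A. f x powr lam)"
  define c where "c = S powr ((1 - lam) / lam)"
  have S0: "S \<ge> 0" unfolding S_def by (rule infsum_nonneg) simp
  \<comment> \<open>Each term is at most \<open>S powr (1 / lam)\<close>, so one may split off the power \<open>1 - lam\<close> of it.\<close>
  have bound: "f x \<le> f x powr lam * c" if x: "x \<in> A" for x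
  proof -
    have "f x powr lam \<le> S"
      unfolding S_def using infsum_mono2[of "\<lambda>x. f x powr lam" "{x}" A] summable x by simp
    then have "(f x powr lam) powr ((1 - lam) / lam) \<le> c"
      unfolding c_def using lam by (intro powr_mono2) auto
    then have "f x powr (1 - lam) \<le> c"
      using lam by (simp add: powr_powr)
    then have "f x powr lam * f x powr (1 - lam) \<le> f x powr lam * c"
      by (intro mult_left_mono) auto
    then show ?thesis
      using nonneg[OF x] by (simp flip: powr_add)
  qed
  have "infsum f A \<le> S * c"
  proof (cases "f summable_on A")
    case True
    have "infsum f A \<le> (\<Sum>\<^sub>\<infinity>x\<in>A. f x powr lam * c)"
      by (intro infsum_mono True summable_on_cmult_left summable bound)
    also have "\<dots> = S * c" unfolding S_def by (rule infsum_cmult_left')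
    finally show ?thesis .
  next
    \<comment> \<open>By \<open>bound\<close> and comparison \<open>f\<close> is in fact summable;
      the default value 0 of \<open>infsum\<close> settles this case without deriving that.\<close>
    case False
    then show ?thesis using S0 by (simp add: infsum_not_exists c_def)
  qed
  then have "infsum f A powr lam \<le> (S * c) powr lam"
    using lam nonneg by (intro powr_mono2 infsum_nonneg) auto
  also have "\<dots> = S"
  proof (cases "S = 0")
    case False
    with S0 have "S powr lam * S powr (1 - lam) = S"
      by (simp flip: powr_add)
    with lam S0 show ?thesis by (simp add: c_def powr_mult powr_powr)
  qed simp
  finally show ?thesis unfolding S_def .
qed

lemma sum_powr_le:
  fixes f :: "'i \<Rightarrow> real"
  assumes "finite A" "\<And>x. x \<in> A \<Longrightarrow> f x \<ge> 0" "0 < lam" "lam \<le> 1"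
  shows "sum f A powr lam \<le> (\<Sum>x\<in>A. f x powr lam)"
  using infsum_powr_le[of A f lam] assms by simp

lemma has_sum_finite_sum:
  fixes f :: "'i \<Rightarrow> 'j \<Rightarrow> real"
  assumes "finite I" "\<And>i. i \<in> I \<Longrightarrow> (f i has_sum S i) A"
  shows "((\<lambda>x. \<Sum>i\<in>I. f i x) has_sum (\<Sum>i\<in>I. S i)) A"
  using assms by (induction I rule: finite_induct) (auto intro: has_sum_add)

section \<open>Counting roots modulo a prime and membership in the dual net\<close>

text \<open>Lagrange's bound on the number of roots over the integral domain of residues modulo
  \<open>p\<close>, phrased by divisibility so that no quotient ring is needed. Splitting off the
  linear factor of one root leaves a cofactor \<open>g\<close>; since \<open>p\<close> is prime, the
  remaining elements of \<open>S\<close> are roots of \<open>g\<close> modulo \<open>p\<close>, and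
  degree and number of roots both drop by one.\<close>

lemma prime_elem_dvd_coeff_if_many_roots:
  fixes p :: "'r::idom"
  assumes "prime_elem p"
    and "finite S" "card S > degree f"
    and "\<And>x y. x \<in> S \<Longrightarrow> y \<in> S \<Longrightarrow> x \<noteq> y \<Longrightarrow> \<not> p dvd x - y"
    and "\<And>x. x \<in> S \<Longrightarrow> p dvd poly f x"
  shows "p dvd coeff f i"
  using assms(2-)
proof (induction "degree f" arbitrary: f S i)
  case 0
  then have "S \<noteq> {}" by auto
  then obtain x where "x \<in> S" by blast
  with 0 have "p dvd poly f x" by blast
  moreover from 0 obtain c where "f = [:c:]" by (metis degree_eq_zeroE)
  ultimately show ?case by (auto simp: coeff_pCons split: nat.splits)
next
  case (Suc n)
  then have "S \<noteq> {}" by auto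
  then obtain x where x: "x \<in> S" by blast
  define g where "g = synthetic_div f x"
  have f: "f = [:-x, 1:] * g + [:poly f x:]"
    unfolding g_def by (rule synthetic_div_correct'[symmetric])
  have fx: "p dvd poly f x" using Suc x by blast
  have "p dvd coeff g i" for i
  proof (rule Suc.hyps(1)[of g "S - {x}"])
    show deg: "n = degree g"
      using Suc.hyps(2) by (simp add: g_def degree_synthetic_div)
    show "degree g < card (S - {x})"
      using Suc.prems Suc.hyps(2) deg x by simp
    show "p dvd poly g y" if y: "y \<in> S - {x}" for y
    proof -
      have "poly f y = (y - x) * poly g y + poly f x"
        by (subst f) (simp add: algebra_simps)
      moreover have "p dvd poly f y" using Suc.prems y by blast
      ultimately have "p dvd (y - x) * poly g y"
        using fx by (simp add: dvd_add_left_iff)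
      moreover have "\<not> p dvd y - x" using Suc.prems y x by blast
      ultimately show ?thesis using assms(1) prime_elem_dvd_multD by blast
    qed
  qed (use Suc.prems in auto)
  then have "[:p:] dvd g" by (simp add: const_poly_dvd_iff)
  moreover have "[:p:] dvd [:poly f x:]"
    using fx by (simp add: const_poly_dvd_const_poly_iff)
  ultimately have "[:p:] dvd f" by (subst f) (rule dvd_add[OF dvd_mult])
  then show ?case by (simp add: const_poly_dvd_iff)
qed

lemma card_R_polys:
  assumes "m \<ge> 1" "finite (UNIV :: 'a::field set)"
  shows "finite (R_polys m :: 'a poly set)"
    and "card (R_polys m :: 'a poly set) = CARD('a) ^ m - 1"
proof -
  let ?P = "{q :: 'a poly. degree q < m}"
  let ?F = "PiE {..<m} (\<lambda>_. UNIV :: 'a set)"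
  let ?poly = "\<lambda>f :: nat \<Rightarrow> 'a. \<Sum>i<m. monom (f i) i"
  have coeff: "coeff (?poly f) i = (if i < m then f i else 0)" for f i
    by (simp add: coeff_sum if_distrib cong: if_cong)
  have bij: "bij_betw ?poly ?F ?P"
  proof (rule bij_betw_byWitness[where f' = "\<lambda>q. restrict (coeff q) {..<m}"])
    show "\<forall>f\<in>?F. restrict (coeff (?poly f)) {..<m} = f"
      by (auto simp: coeff fun_eq_iff PiE_def extensional_def)
    show "\<forall>q\<in>?P. ?poly (restrict (coeff q) {..<m}) = q"
      by (auto simp: poly_eq_iff coeff coeff_eq_0)
    show "?poly ` ?F \<subseteq> ?P"
    proof safe
      fix f
      have "degree (?poly f) \<le> m - 1"
        by (rule degree_le) (use assms(1) in \<open>auto simp: coeff\<close>)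
      then show "degree (?poly f) < m" using assms(1) by simp
    qed
  qed (auto split: if_splits)
  have "finite ?F" using assms(2) by (intro finite_PiE) auto
  then have fin: "finite ?P" using bij bij_betw_finite by blast
  have "card ?P = CARD('a) ^ m"
    using bij_betw_same_card[OF bij] by (simp add: card_PiE)
  moreover have R: "R_polys m = ?P - {0}" unfolding R_polys_def by auto
  ultimately show "card (R_polys m :: 'a poly set) = CARD('a) ^ m - 1"
    using assms(1) by simp
  show "finite (R_polys m :: 'a poly set)" unfolding R using fin by simp
qed

text \<open>The coefficients of \<open>tr b m k\<close> vanish from index \<open>m\<close> on, so a
  multiple of \<open>p\<close> of this shape must be zero. Its coefficients are the lowest
  \<open>m\<close> digits of \<open>k\<close>, and \<open>of_nat\<close> is injective on digits, so
  all of these digits are zero.\<close>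

lemma dvd_tr_imp_power_dvd:
  fixes p :: "'a::field poly"
  assumes "prime b" "CARD('a) = b" "degree p = m" and dvd: "p dvd tr b m k"
  shows "b ^ m dvd k"
proof -
  have coeff: "coeff (tr b m k :: 'a poly) i = (if i < m then of_nat (k div b ^ i mod b) else 0)" for i
    by (simp add: tr_def coeff_sum if_distrib cong: if_cong)
  have "(tr b m k :: 'a poly) = 0"
  proof (rule ccontr)
    assume nz: "(tr b m k :: 'a poly) \<noteq> 0"
    then have "m \<le> degree (tr b m k :: 'a poly)"
      using dvd_imp_degree_le[OF dvd] assms(3) by simp
    with nz show False using coeff[of "degree (tr b m k :: 'a poly)"] by simp
  qed
  then have zero: "(of_nat (k div b ^ i mod b) :: 'a) = 0" if "i < m" for i
    using coeff[of i] that by simp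
  have digit: "k div b ^ i mod b = 0" if "i < m" for i
  proof -
    have "inj_on (of_nat :: nat \<Rightarrow> 'a) {0..<b}"
      using bij_betw_of_nat_prime_field[OF assms(1,2)] by (simp add: bij_betw_def)
    moreover have "b > 0" using assms(1) by (simp add: prime_gt_0_nat)
    ultimately show ?thesis
      using zero[OF that] inj_onD[of "of_nat :: nat \<Rightarrow> 'a" "{0..<b}" "k div b ^ i mod b" 0] by simp
  qed
  have "b ^ i dvd k" if "i \<le> m" for i
    using that
  proof (induction i)
    case (Suc i)
    then have "b ^ i * (k div b ^ i) = k" by simp
    moreover have "b dvd k div b ^ i" using digit[of i] Suc by auto
    then have "b ^ i * b dvd b ^ i * (k div b ^ i)" by (rule mult_dvd_mono[OF dvd_refl])
    ultimately show ?case by (simp add: mult.commute)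
  qed simp
  then show ?thesis by blast
qed

text \<open>For a Korobov vector the dual net condition says that \<open>q\<close> is a root modulo
  \<open>p\<close> of one polynomial that does not depend on \<open>q\<close>. More than
  \<open>n - 1\<close> such roots would force \<open>p\<close> to divide all its coefficients, hence
  \<open>b ^ m\<close> to divide all components of \<open>k\<close>.\<close>

lemma card_dual_korobov_le:
  fixes p :: "'a::field poly"
  assumes "prime b" "CARD('a) = b" "m \<ge> 1" "irreducible p" "degree p = m"
    and u: "u \<subseteq> {1..n}" and n: "n \<ge> 1" and nd: "\<not> (\<forall>j\<in>u. b ^ m dvd k j)"
  shows "card {q \<in> R_polys m. zero_ext n u k \<in> dual_net b m n (psi p q) p} \<le> n - 1"
proof (rule ccontr)
  let ?S = "{q \<in> R_polys m. zero_ext n u k \<in> dual_net b m n (psi p q) p}"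
  let ?k = "zero_ext n u k"
  \<comment> \<open>The coefficients of \<open>f\<close> are themselves polynomials over the finite
    field. Components are numbered from 1 but exponents from 0, whence the shift and the degree
    bound \<open>n - 1\<close>.\<close>
  define f :: "'a poly poly" where "f = (\<Sum>i<n. monom (tr b m (?k (i + 1))) i)"
  have coeff: "coeff f i = (if i < n then tr b m (?k (i + 1)) else 0)" for i
    by (simp add: f_def coeff_sum if_distrib cong: if_cong)
  assume "\<not> ?thesis"
  moreover have "degree f \<le> n - 1"
    by (rule degree_le) (use n in \<open>auto simp: coeff\<close>)
  ultimately have card: "card ?S > degree f" by linarith
  have fin: "finite (UNIV :: 'a set)"
    using assms(1,2) by (metis card.infinite not_prime_0)
  have "p dvd coeff f i" for i
  proof (rule prime_elem_dvd_coeff_if_many_roots[OF _ _ card])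
    show "prime_elem p" using assms(4) by (rule field_poly_irreducible_imp_prime)
    show "finite ?S" using card_R_polys(1)[OF assms(3) fin] by simp
    \<comment> \<open>Distinct candidates stay distinct modulo \<open>p\<close>, because their
      difference has degree below \<open>m\<close>.\<close>
    show "\<not> p dvd x - y" if "x \<in> ?S" "y \<in> ?S" "x \<noteq> y" for x y
    proof
      assume "p dvd x - y"
      then have "m \<le> degree (x - y)"
        using that(3) assms(5) dvd_imp_degree_le[of p "x - y"] by simp
      moreover have "degree (x - y) < m"
        using that by (intro degree_diff_less) (auto simp: R_polys_def)
      ultimately show False by simp
    qed
    show "p dvd poly f q" if "q \<in> ?S" for q
    proof -
      have "[(\<Sum>j = 1..n. tr b m (?k j) * psi p q j) = 0] (mod p)"
        using that by (simp add: dual_net_def)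
      moreover have "[(\<Sum>j = 1..n. tr b m (?k j) * psi p q j)
          = (\<Sum>j = 1..n. tr b m (?k j) * q ^ (j - 1))] (mod p)"
        by (intro cong_sum cong_mult cong_refl) (simp add: psi_def)
      moreover have "(\<Sum>j = 1..n. tr b m (?k j) * q ^ (j - 1)) = poly f q"
        by (simp add: f_def poly_sum poly_monom sum.atLeast1_atMost_eq)
      ultimately have "[poly f q = 0] (mod p)" by (simp add: cong_def)
      then show ?thesis by (simp add: cong_0_iff)
    qed
  qed
  have "b ^ m dvd k j" if "j \<in> u" for j
  proof -
    have "j \<ge> 1" "j \<le> n" using that u by auto
    then have "p dvd tr b m (?k j)"
      using \<open>p dvd coeff f (j - 1)\<close> unfolding coeff by (simp split: if_splits)
    moreover have "?k j = k j" using that u by (auto simp: zero_ext_def)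
    ultimately show ?thesis using dvd_tr_imp_power_dvd assms(1,2,5) by metis
  qed
  with nd show False by blast
qed

section \<open>Closed forms for sums of powers of \<open>r_tilde\<close>\<close>

text \<open>Nonnegativity upgrades summability of the factors to absolute summability, under which
  an infinite sum of products over a finite product set factorizes.\<close>

lemma has_sum_prod_PiE_nonneg:
  fixes f :: "'i \<Rightarrow> 'j::countable \<Rightarrow> real"
  assumes "finite I" and sum: "\<And>i. i \<in> I \<Longrightarrow> (f i has_sum S i) (B i)"
    and nonneg: "\<And>i x. i \<in> I \<Longrightarrow> x \<in> B i \<Longrightarrow> f i x \<ge> 0"
  shows "((\<lambda>g. \<Prod>i\<in>I. f i (g i)) has_sum (\<Prod>i\<in>I. S i)) (PiE I B)"
proof -
  have abs: "Infinite_Sum.abs_summable_on (f i) (B i)" if "i \<in> I" for i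
  proof -
    have "f i summable_on B i" using sum[OF that] by (rule has_sum_imp_summable)
    moreover have "(\<lambda>x. norm (f i x)) summable_on B i \<longleftrightarrow> f i summable_on B i"
      using nonneg[OF that] by (intro summable_on_cong) simp
    ultimately show ?thesis by blast
  qed
  have "Infinite_Set_Sum.abs_summable_on (\<lambda>g. \<Prod>i\<in>I. f i (g i)) (PiE I B)"
    using assms(1) abs unfolding abs_summable_equivalent by (intro abs_summable_on_prod_PiE) auto
  then have "(\<lambda>g. \<Prod>i\<in>I. f i (g i)) summable_on (PiE I B)"
    by (metis abs_summable_equivalent abs_summable_summable)
  moreover have "infsum (\<lambda>g. \<Prod>i\<in>I. f i (g i)) (PiE I B) = (\<Prod>i\<in>I. infsum (f i) (B i))"
    using assms(1) abs by (rule infsum_prod_PiE_abs)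
  moreover have "infsum (f i) (B i) = S i" if "i \<in> I" for i
    using sum[OF that] by (rule infsumI)
  ultimately show ?thesis by (simp add: has_sum_iff)
qed

lemma mu1_power_mult:
  assumes "b \<ge> 2" "k \<ge> 1"
  shows "mu1 b (b ^ m * k) = mu1 b k + m"
proof -
  have a: "mu1 b k \<ge> 1" "b ^ (mu1 b k - 1) \<le> k" "k < b ^ mu1 b k"
    using mu1_eq_iff[OF assms, of "mu1 b k"] by auto
  have "b ^ m * b ^ (mu1 b k - 1) \<le> b ^ m * k" using a by simp
  moreover have "b ^ m * k < b ^ m * b ^ mu1 b k" using a assms by simp
  moreover have "b ^ m * k \<ge> 1" using assms by simp
  moreover have "mu1 b k + m - 1 = m + (mu1 b k - 1)" using a by simp
  moreover have "mu1 b k + m = m + mu1 b k" by simp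
  ultimately show ?thesis
    using a(1) by (subst mu1_eq_iff[OF assms(1)]) (simp_all only: power_add, simp)
qed

text \<open>Sorting the positive integers by their number \<open>a\<close> of digits makes the
  summand constant on each class and leaves a geometric series with ratio
  \<open>b * y\<close>.\<close>

lemma has_sum_power_mu1:
  fixes y :: real
  assumes b: "b \<ge> 2" and y: "0 \<le> y" "real b * y < 1"
  shows "((\<lambda>k. y ^ mu1 b k) has_sum ((real b - 1) * y / (1 - real b * y))) {1..}"
proof -
  let ?B = "\<lambda>a. {b ^ (a - 1)..<b ^ a}"
  \<comment> \<open>There are \<open>b ^ a - b ^ (a - 1)\<close> integers with \<open>a\<close>
    digits, that is, \<open>(b - 1) / b\<close> times \<open>b ^ a\<close>.\<close>
  let ?g = "\<lambda>a. (real b - 1) / real b * (real b * y) ^ a"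
  have mu: "mu1 b k = a" if "a \<in> {1..}" "k \<in> ?B a" for a k
  proof -
    have "1 \<le> b ^ (a - 1)" using b by simp
    also have "\<dots> \<le> k" using that by simp
    finally have "k \<ge> 1" .
    then show ?thesis using that b by (subst mu1_eq_iff) auto
  qed
  have inner: "((\<lambda>k. y ^ mu1 b (snd (a, k))) has_sum ?g a) (?B a)" if a: "a \<in> {1..}" for a
  proof (rule has_sum_finiteI)
    obtain c where c: "a = Suc c" using a by (cases a) auto
    have "(\<Sum>k\<in>?B a. y ^ mu1 b (snd (a, k))) = (\<Sum>k\<in>?B a. y ^ a)"
      using mu[OF a] by (intro sum.cong) auto
    also have "\<dots> = real (b ^ a - b ^ (a - 1)) * y ^ a" by simp
    also have "\<dots> = (real b ^ a - real b ^ (a - 1)) * y ^ a"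
      using b by (subst of_nat_diff) (auto intro: power_increasing)
    also have "\<dots> = ?g a" using b by (simp add: c power_mult_distrib field_simps)
    finally show "?g a = (\<Sum>k\<in>?B a. y ^ mu1 b (snd (a, k)))" by simp
  qed auto
  have "((\<lambda>a. (real b * y) ^ a) has_sum (real b * y / (1 - real b * y))) {1..}"
    using y b by (intro has_sum_geometric_from_1) simp
  from has_sum_cmult_right[OF this, of "(real b - 1) / real b"]
  have outer: "(?g has_sum ((real b - 1) * y / (1 - real b * y))) {1..}"
    using b by simp
  have "((\<lambda>x. y ^ mu1 b (snd x)) has_sum ((real b - 1) * y / (1 - real b * y))) (Sigma {1..} ?B)"
  proof (rule has_sum_SigmaI[OF inner outer])
    show "(\<lambda>x. y ^ mu1 b (snd x)) summable_on Sigma {1..} ?B"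
      by (rule summable_on_SigmaI[OF inner has_sum_imp_summable[OF outer]]) (use y in auto)
  qed
  \<comment> \<open>The digit count in the first component is recovered from the integer by
    \<open>mu1\<close>, so the classes are disjoint.\<close>
  moreover have "inj_on snd (Sigma {1..} ?B)"
  proof (rule inj_onI)
    fix x x' assume x: "x \<in> Sigma {1..} ?B" "x' \<in> Sigma {1..} ?B" and "snd x = snd x'"
    moreover have "mu1 b (snd x) = fst x" "mu1 b (snd x') = fst x'"
      using x mu[of "fst x" "snd x"] mu[of "fst x'" "snd x'"] by auto
    ultimately show "x = x'" by (simp add: prod_eq_iff)
  qed
  moreover have "snd ` Sigma {1..} ?B = {1..}"
  proof
    show "snd ` Sigma {1..} ?B \<subseteq> {1..}"
    proof (rule image_subsetI)
      fix x assume x: "x \<in> Sigma {1..} ?B"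
      have "1 \<le> b ^ (fst x - 1)" using b by simp
      also have "\<dots> \<le> snd x" using x by auto
      finally show "snd x \<in> {1..}" by simp
    qed
    show "{1..} \<subseteq> snd ` Sigma {1..} ?B"
    proof
      fix k :: nat assume "k \<in> {1..}"
      then have "(mu1 b k, k) \<in> Sigma {1..} ?B" using mu1_eq_iff[OF b, of k "mu1 b k"] by auto
      then show "k \<in> snd ` Sigma {1..} ?B" by (metis image_eqI snd_conv)
    qed
  qed
  ultimately show ?thesis
    using has_sum_reindex[of snd "Sigma {1..} ?B" "\<lambda>k. y ^ mu1 b k"] by (simp add: o_def)
qed

lemma r_tilde_powr:
  assumes "b \<ge> 2" "k \<ge> 1"
  shows "r_tilde b d j k powr lam = real b powr (lam * (real d * \<lceil>real j / real d\<rceil> - real j)) *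
    (real b powr (- (lam * real d))) ^ mu1 b k"
proof -
  have "r_tilde b d j k = real b powr (real_of_int (- int d * int (mu1 b k) - int j + int d * \<lceil>real j / real d\<rceil>))"
    using assms by (subst powr_real_of_int') (auto simp: r_tilde_def)
  then have "r_tilde b d j k powr lam = real b powr
      (lam * (real d * \<lceil>real j / real d\<rceil> - real j) + real (mu1 b k) * (- (lam * real d)))"
    by (simp add: powr_powr algebra_simps)
  also have "\<dots> = real b powr (lam * (real d * \<lceil>real j / real d\<rceil> - real j)) *
      (real b powr (- (lam * real d))) powr real (mu1 b k)"
    by (simp only: powr_add powr_powr mult.commute)
  finally show ?thesis using assms by (simp add: powr_realpow)
qed

text \<open>The weight of coordinate \<open>j\<close> when its component runs freely over all
  positive integers. For \<open>d \<le> \<alpha>\<close> the last factor is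
  \<open>H_tilde b \<alpha> d lam\<close>.\<close>

definition r_tilde_powr_sum :: "nat \<Rightarrow> nat \<Rightarrow> real \<Rightarrow> nat \<Rightarrow> real" where
  "r_tilde_powr_sum b d lam j =
     real b powr (lam * (real d * \<lceil>real j / real d\<rceil> - real j)) *
     ((real b - 1) / (real b powr (lam * real d) - real b))"

text \<open>This is where the lower bound on \<open>lam\<close> enters: it makes the geometric
  series converge and the denominators positive.\<close>

lemma powr_lam_d_gt:
  assumes "b \<ge> 2" "lam * real d > 1"
  shows "real b powr (lam * real d) > real b"
  using powr_less_mono[of 1 "lam * real d" "real b"] assms by simp

lemma r_tilde_powr_sum_nonneg:
  assumes "b \<ge> 2" "lam * real d > 1"
  shows "r_tilde_powr_sum b d lam j \<ge> 0"
  using powr_lam_d_gt[OF assms] assms(1) by (simp add: r_tilde_powr_sum_def)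

lemma has_sum_r_tilde_powr:
  assumes b: "b \<ge> 2" and lam: "lam * real d > 1"
  shows "((\<lambda>k. r_tilde b d j k powr lam) has_sum r_tilde_powr_sum b d lam j) {1..}"
proof -
  let ?c = "real b powr (lam * (real d * \<lceil>real j / real d\<rceil> - real j))"
  define z where "z = real b powr (lam * real d)"
  define y where "y = real b powr (- (lam * real d))"
  have z: "z > real b" unfolding z_def by (rule powr_lam_d_gt[OF assms])
  have yz: "y = 1 / z" by (simp add: y_def z_def powr_minus_divide)
  have "real b * y < 1" using z b by (simp add: yz)
  then have "((\<lambda>k. y ^ mu1 b k) has_sum ((real b - 1) * y / (1 - real b * y))) {1..}"
    using b by (intro has_sum_power_mu1) (simp_all add: y_def)
  also have "(real b - 1) * y / (1 - real b * y) = (real b - 1) / (z - real b)"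
    using z b by (simp add: yz field_simps)
  finally have "((\<lambda>k. ?c * y ^ mu1 b k) has_sum ?c * ((real b - 1) / (z - real b))) {1..}"
    by (rule has_sum_cmult_right)
  then have "((\<lambda>k. ?c * y ^ mu1 b k) has_sum r_tilde_powr_sum b d lam j) {1..}"
    by (simp add: r_tilde_powr_sum_def z_def)
  then show ?thesis
    by (subst has_sum_cong[where g = "\<lambda>k. ?c * y ^ mu1 b k"])
      (use b in \<open>auto simp: r_tilde_powr y_def\<close>)
qed

text \<open>Multiplication by \<open>b ^ m\<close> appends \<open>m\<close> zero digits, so it
  scales every term by the same factor, namely the \<open>m\<close>-th power of
  \<open>b powr (- (lam * d))\<close>.\<close>

lemma has_sum_r_tilde_powr_multiples:
  assumes b: "b \<ge> 2" and lam: "lam * real d > 1"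
  shows "((\<lambda>k. r_tilde b d j k powr lam) has_sum
    (real b powr (- (lam * real d))) ^ m * r_tilde_powr_sum b d lam j) {k \<in> {1..}. b ^ m dvd k}"
proof -
  have "{k \<in> {1..}. b ^ m dvd k} = (*) (b ^ m) ` {1..}"
    using b by (auto elim!: dvdE)
  moreover have "inj_on ((*) (b ^ m)) {1..}" using b by (simp add: inj_on_def)
  moreover have "((\<lambda>k. r_tilde b d j (b ^ m * k) powr lam) has_sum
      (real b powr (- (lam * real d))) ^ m * r_tilde_powr_sum b d lam j) {1..}"
  proof (subst has_sum_cong)
    show "((\<lambda>k. (real b powr (- (lam * real d))) ^ m * r_tilde b d j k powr lam) has_sum
      (real b powr (- (lam * real d))) ^ m * r_tilde_powr_sum b d lam j) {1..}"
      by (intro has_sum_cmult_right has_sum_r_tilde_powr assms)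
    show "r_tilde b d j (b ^ m * k) powr lam
        = (real b powr (- (lam * real d))) ^ m * r_tilde b d j k powr lam" if "k \<in> {1..}" for k
      using that b by (simp add: r_tilde_powr mu1_power_mult power_add del: powr_power)
  qed
  ultimately show ?thesis by (simp add: has_sum_reindex o_def)
qed

lemma r_tilde_prod_powr:
  "finite u \<Longrightarrow> r_tilde_prod b d u k powr lam = (\<Prod>j\<in>u. r_tilde b d j (k j) powr lam)"
  by (simp add: r_tilde_prod_def prod_powr_distrib r_tilde_nonneg)

section \<open>Summation over all Korobov candidates\<close>

lemma sum_dual_korobov_le:
  fixes p :: "'a::field poly"
  assumes "prime b" "CARD('a) = b" "m \<ge> 1" "irreducible p" "degree p = m"
    and u: "u \<subseteq> {1..n}" "u \<noteq> {}" and lam: "lam * real d > 1"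
  shows "(\<Sum>q\<in>R_polys m. \<Sum>\<^sub>\<infinity>k | k \<in> u \<rightarrow>\<^sub>E {1..} \<and> zero_ext n u k \<in> dual_net b m n (psi p q) p.
      r_tilde_prod b d u k powr lam) \<le> real n * (\<Prod>j\<in>u. r_tilde_powr_sum b d lam j)"
proof -
  let ?P = "u \<rightarrow>\<^sub>E {1::nat..}"
  let ?R = "\<lambda>k. r_tilde_prod b d u k powr lam"
  let ?D = "\<lambda>q k. zero_ext n u k \<in> dual_net b m n (psi p q) p"
  let ?all = "\<lambda>k. \<forall>j\<in>u. b ^ m dvd k j"
  let ?G = "\<Prod>j\<in>u. r_tilde_powr_sum b d lam j"
  define y where "y = (real b powr (- (lam * real d))) ^ m"
  have b: "b \<ge> 2" using assms(1) by (rule prime_ge_2_nat)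
  have finu: "finite u" using u(1) finite_subset by blast
  have n: "n \<ge> 1" using u by auto
  have G: "?G \<ge> 0" by (intro prod_nonneg r_tilde_powr_sum_nonneg b lam)
  have finUNIV: "finite (UNIV :: 'a set)"
    using assms(2) b by (metis card.infinite not_numeral_le_zero)
  note R_polys = card_R_polys[OF assms(3) finUNIV]
  have total: "(?R has_sum ?G) ?P"
    unfolding r_tilde_prod_powr[OF finu]
    by (rule has_sum_prod_PiE_nonneg[OF finu]) (use has_sum_r_tilde_powr[OF b lam] in auto)
  have "(?R has_sum (\<Prod>j\<in>u. y * r_tilde_powr_sum b d lam j)) (PiE u (\<lambda>_. {k \<in> {1..}. b ^ m dvd k}))"
    unfolding r_tilde_prod_powr[OF finu] y_def
    by (rule has_sum_prod_PiE_nonneg[OF finu])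
      (use has_sum_r_tilde_powr_multiples[OF b lam] in auto)
  moreover have "PiE u (\<lambda>_. {k \<in> {1..}. b ^ m dvd k}) = {k \<in> ?P. ?all k}"
    by (auto simp: PiE_def Pi_def)
  ultimately have "(?R has_sum (y ^ card u * ?G)) {k \<in> ?P. ?all k}"
    by (simp add: prod.distrib)
  \<comment> \<open>Padding with zeros moves all restricted sums to the common index set
    \<open>?P\<close>, where they can be added and compared term by term.\<close>
  then have multiples: "((\<lambda>k. if ?all k then ?R k else 0) has_sum (y ^ card u * ?G)) ?P"
    by (rule has_sum_cong_neutral[THEN iffD1, rotated -1]) auto
  have "((\<lambda>k. if ?D q k then ?R k else 0) has_sum (\<Sum>\<^sub>\<infinity>k | k \<in> ?P \<and> ?D q k. ?R k)) ?P" for q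
  proof -
    have "?R summable_on {k. k \<in> ?P \<and> ?D q k}"
      using has_sum_imp_summable[OF total] by (rule summable_on_subset_banach) auto
    then have "(?R has_sum (\<Sum>\<^sub>\<infinity>k | k \<in> ?P \<and> ?D q k. ?R k)) {k. k \<in> ?P \<and> ?D q k}" by simp
    then show ?thesis by (rule has_sum_cong_neutral[THEN iffD1, rotated -1]) auto
  qed
  then have "((\<lambda>k. \<Sum>q\<in>R_polys m. if ?D q k then ?R k else 0) has_sum
      (\<Sum>q\<in>R_polys m. \<Sum>\<^sub>\<infinity>k | k \<in> ?P \<and> ?D q k. ?R k)) ?P"
    by (intro has_sum_finite_sum R_polys)
  moreover have "((\<lambda>k. (real n - 1) * ?R k + (real b ^ m - 1) * (if ?all k then ?R k else 0)) has_sum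
      (real n - 1) * ?G + (real b ^ m - 1) * (y ^ card u * ?G)) ?P"
    by (intro has_sum_add has_sum_cmult_right total multiples)
  moreover have "(\<Sum>q\<in>R_polys m. if ?D q k then ?R k else 0)
      \<le> (real n - 1) * ?R k + (real b ^ m - 1) * (if ?all k then ?R k else 0)" for k
  proof -
    have "(\<Sum>q\<in>R_polys m. if ?D q k then ?R k else 0) = real (card {q \<in> R_polys m. ?D q k}) * ?R k"
      using R_polys(1) by (simp add: sum.If_cases Int_def)
    \<comment> \<open>If all components are multiples of \<open>b ^ m\<close>, only the trivial
      bound by the number of candidates is available; otherwise root counting applies.\<close>
    also have "real (card {q \<in> R_polys m. ?D q k}) \<le> (real n - 1) + (if ?all k then real b ^ m - 1 else 0)"
    proof (cases "?all k")
      case True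
      have "card {q \<in> R_polys m. ?D q k} \<le> b ^ m - 1"
        using R_polys assms(2) card_mono[OF R_polys(1), of "{q \<in> R_polys m. ?D q k}"] by auto
      then have "real (card {q \<in> R_polys m. ?D q k}) \<le> real (b ^ m - 1)" by (rule of_nat_mono)
      with True b n show ?thesis by (simp add: of_nat_diff)
    next
      case False
      have "card {q \<in> R_polys m. ?D q k} \<le> n - 1"
        by (rule card_dual_korobov_le) (use assms n False in auto)
      then have "real (card {q \<in> R_polys m. ?D q k}) \<le> real (n - 1)" by (rule of_nat_mono)
      with n show ?thesis unfolding if_not_P[OF False] by (simp add: of_nat_diff)
    qed
    finally have "(\<Sum>q\<in>R_polys m. if ?D q k then ?R k else 0)
        \<le> ((real n - 1) + (if ?all k then real b ^ m - 1 else 0)) * ?R k"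
      by (simp add: mult_right_mono)
    also have "\<dots> = (real n - 1) * ?R k + (real b ^ m - 1) * (if ?all k then ?R k else 0)"
      unfolding distrib_right if_distrib[of "\<lambda>x. x * ?R k"] if_distrib[of "\<lambda>x. (real b ^ m - 1) * x"]
      by simp
    finally show ?thesis .
  qed
  ultimately have "(\<Sum>q\<in>R_polys m. \<Sum>\<^sub>\<infinity>k | k \<in> ?P \<and> ?D q k. ?R k)
      \<le> (real n - 1) * ?G + (real b ^ m - 1) * (y ^ card u * ?G)"
    by (rule has_sum_mono)
  \<comment> \<open>Since \<open>lam * d > 1\<close>, \<open>y\<close> is at most \<open>b\<close>
    to the power \<open>-m\<close>, and \<open>u\<close> is nonempty. The exceptional vectors
    therefore cost at most one further copy of \<open>?G\<close>, raising the factor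
    \<open>n - 1\<close> to \<open>n\<close>.\<close>
  also have "(real b ^ m - 1) * y ^ card u \<le> 1"
  proof -
    have yb: "y \<le> 1 / real b ^ m"
    proof -
      have "real b powr (- (lam * real d)) \<le> real b powr - 1"
        using lam b by (intro powr_mono) auto
      also have "\<dots> = 1 / real b" using b by (simp add: powr_minus_divide)
      finally have "y \<le> (1 / real b) ^ m" unfolding y_def by (intro power_mono) auto
      then show ?thesis by (simp add: power_one_over)
    qed
    have "1 \<le> real b ^ m" using b by simp
    have "y \<ge> 0" by (simp add: y_def)
    moreover have "y \<le> 1" using yb \<open>1 \<le> real b ^ m\<close> by (smt (verit) divide_le_eq_1)
    moreover have "card u \<ge> 1" using u(2) finu by (simp add: Suc_leI card_gt_0_iff)
    ultimately have "y ^ card u \<le> y" using power_decreasing[of 1 "card u" y] by simp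
    then have "(real b ^ m - 1) * y ^ card u \<le> real b ^ m * (1 / real b ^ m)"
      using yb \<open>1 \<le> real b ^ m\<close> \<open>y \<ge> 0\<close> by (intro mult_mono) auto
    with b show ?thesis by simp
  qed
  then have "(real n - 1) * ?G + (real b ^ m - 1) * (y ^ card u * ?G) \<le> (real n - 1) * ?G + 1 * ?G"
    unfolding mult.assoc[symmetric] by (intro add_left_mono mult_right_mono G)
  finally show ?thesis by (simp add: algebra_simps)
qed

section \<open>Regrouping coordinate subsets by blocks of length \<open>d\<close>\<close>

text \<open>Within block \<open>i\<close> the ceiling in the exponent is constantly
  \<open>i\<close>, so the weight depends only on the position \<open>l\<close>. Hence all blocks
  yield the same product.\<close>

lemma r_tilde_powr_sum_block:
  assumes "i \<ge> 1" "d \<ge> 1" "l \<in> {1..d}"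
  shows "r_tilde_powr_sum b d lam ((i - 1) * d + l) =
    real b powr (lam * (real d - real l)) * ((real b - 1) / (real b powr (lam * real d) - real b))"
proof -
  have "real ((i - 1) * d + l) / real d = real (i - 1) + real l / real d"
    using assms by (simp add: add_divide_distrib)
  moreover have "0 < real l / real d" "real l / real d \<le> 1" using assms by auto
  ultimately have ceil: "\<lceil>real ((i - 1) * d + l) / real d\<rceil> = int i"
    using assms(1) by (intro ceiling_unique) (auto simp: of_nat_diff)
  have "real d * real i - real ((i - 1) * d + l) = real d - real l"
    using assms(1) by (cases i) (simp_all add: algebra_simps)
  then show ?thesis unfolding r_tilde_powr_sum_def ceil of_int_of_nat_eq by (simp only:)
qed

lemma sum_nonempty_subsets_prod:
  fixes g :: "'i \<Rightarrow> 'r::comm_ring_1"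
  assumes "finite I"
  shows "(\<Sum>u\<in>Pow I - {{}}. \<Prod>j\<in>u. g j) = (\<Prod>j\<in>I. 1 + g j) - 1"
proof -
  have "(\<Prod>j\<in>I. g j + 1) = (\<Sum>u\<in>Pow I. \<Prod>j\<in>u. g j)"
    using prod_add[OF assms, of g "\<lambda>_. 1"] by simp
  also have "\<dots> = 1 + (\<Sum>u\<in>Pow I - {{}}. \<Prod>j\<in>u. g j)"
    using assms by (subst sum.remove[of _ "{}"]) auto
  finally show ?thesis by (simp add: add.commute)
qed

text \<open>A set meeting every block amounts to an independent choice of one nonempty subset per
  block, so the sum factorizes by distributivity. Leaving out the empty subset accounts for the
  subtracted 1.\<close>

lemma sum_subsets_by_blocks:
  fixes g :: "'i \<Rightarrow> 'r::comm_ring_1"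
  assumes "finite v" and fin: "\<And>i. i \<in> v \<Longrightarrow> finite (B i)"
    and disj: "disjoint_family_on B v"
  shows "(\<Sum>u | u \<subseteq> (\<Union>i\<in>v. B i) \<and> (\<forall>i\<in>v. u \<inter> B i \<noteq> {}). \<Prod>j\<in>u. g j)
    = (\<Prod>i\<in>v. (\<Prod>j\<in>B i. 1 + g j) - 1)"
proof -
  let ?U = "{u. u \<subseteq> (\<Union>i\<in>v. B i) \<and> (\<forall>i\<in>v. u \<inter> B i \<noteq> {})}"
  let ?F = "PiE v (\<lambda>i. Pow (B i) - {{}})"
  \<comment> \<open>Disjointness of the blocks lets each chosen piece be recovered from the union by
    intersecting with its block.\<close>
  have glue: "(\<Union>i\<in>v. F i) \<inter> B i = F i" if "F \<in> ?F" "i \<in> v" for F i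
  proof -
    have "F l \<inter> B i = {}" if "l \<in> v" "l \<noteq> i" for l
    proof -
      have "F l \<subseteq> B l" using \<open>F \<in> ?F\<close> that by auto
      moreover have "B l \<inter> B i = {}"
        using disj that \<open>i \<in> v\<close> by (auto simp: disjoint_family_on_def)
      ultimately show ?thesis by blast
    qed
    moreover have "F i \<subseteq> B i" using that by auto
    ultimately show ?thesis using \<open>i \<in> v\<close> by blast
  qed
  have bij: "bij_betw (\<lambda>F. \<Union>i\<in>v. F i) ?F ?U"
  proof (rule bij_betw_byWitness[where f' = "\<lambda>u. \<lambda>i\<in>v. u \<inter> B i"])
    show "\<forall>F\<in>?F. (\<lambda>i\<in>v. (\<Union>i\<in>v. F i) \<inter> B i) = F"
    proof
      fix F assume F: "F \<in> ?F"
      show "(\<lambda>i\<in>v. (\<Union>i\<in>v. F i) \<inter> B i) = F"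
        by (rule extensionalityI[of _ v]) (use F glue[OF F] in \<open>auto simp: PiE_def\<close>)
    qed
    show "(\<lambda>F. \<Union>i\<in>v. F i) ` ?F \<subseteq> ?U"
    proof (rule image_subsetI)
      fix F assume F: "F \<in> ?F"
      have "(\<Union>i\<in>v. F i) \<inter> B i \<noteq> {}" if "i \<in> v" for i
        unfolding glue[OF F that] using F that by auto
      moreover have "(\<Union>i\<in>v. F i) \<subseteq> (\<Union>i\<in>v. B i)" using F by (auto simp: PiE_def Pi_def)
      ultimately show "(\<Union>i\<in>v. F i) \<in> ?U" by blast
    qed
  qed auto
  have "(\<Sum>u\<in>?U. \<Prod>j\<in>u. g j) = (\<Sum>F\<in>?F. \<Prod>j\<in>(\<Union>i\<in>v. F i). g j)"
    by (rule sum.reindex_bij_betw[OF bij, symmetric])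
  also have "\<dots> = (\<Sum>F\<in>?F. \<Prod>i\<in>v. \<Prod>j\<in>F i. g j)"
  proof (intro sum.cong refl prod.UNION_disjoint)
    fix F assume F: "F \<in> ?F"
    show "\<forall>i\<in>v. finite (F i)"
    proof
      fix i assume "i \<in> v"
      then show "finite (F i)" using F fin[of i] by (auto intro: finite_subset)
    qed
    show "\<forall>i\<in>v. \<forall>l\<in>v. i \<noteq> l \<longrightarrow> F i \<inter> F l = {}"
    proof (intro ballI impI)
      fix i l assume "i \<in> v" "l \<in> v" "i \<noteq> l"
      then have "F i \<subseteq> B i" "F l \<subseteq> B l" "B i \<inter> B l = {}"
        using F disj by (auto simp: disjoint_family_on_def)
      then show "F i \<inter> F l = {}" by blast
    qed
  qed (use assms in auto)
  also have "\<dots> = (\<Prod>i\<in>v. \<Sum>u\<in>Pow (B i) - {{}}. \<Prod>j\<in>u. g j)"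
    by (rule prod_sum_PiE[symmetric]) (use assms in auto)
  also have "\<dots> = (\<Prod>i\<in>v. (\<Prod>j\<in>B i. 1 + g j) - 1)"
    by (intro prod.cong refl sum_nonempty_subsets_prod fin)
  finally show ?thesis .
qed

text \<open>Group the subsets \<open>u\<close> by the set \<open>v\<close> of blocks that they meet:
  the weight is constant on a group, and every block in \<open>v\<close> contributes one factor
  \<open>H\<close>.\<close>

lemma sum_by_w_set:
  fixes g :: "nat \<Rightarrow> real" and c :: "nat set \<Rightarrow> real"
  assumes d: "d \<ge> 1" and block: "\<And>i. i \<in> {1..s} \<Longrightarrow> (\<Prod>l = 1..d. 1 + g ((i - 1) * d + l)) - 1 = H"
  shows "(\<Sum>u | u \<noteq> {} \<and> u \<subseteq> {1..d * s}. c (w_set d s u) * (\<Prod>j\<in>u. g j))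
    = (\<Sum>v | v \<noteq> {} \<and> v \<subseteq> {1..s}. c v * H ^ card v)"
proof -
  let ?B = "\<lambda>i. {(i - 1) * d + 1..i * d}"
  let ?U = "{u. u \<noteq> {} \<and> u \<subseteq> {1..d * s}}"
  let ?V = "{v. v \<noteq> {} \<and> v \<subseteq> {1..s}}"
  \<comment> \<open>The blocks partition the positive indices; the quotient by \<open>d\<close> must
    be taken of \<open>j - 1\<close> because both blocks and coordinates are numbered from
    1.\<close>
  have in_block: "j \<in> ?B i \<longleftrightarrow> i = (j - 1) div d + 1" if "i \<ge> 1" "j \<ge> 1" for i j
  proof -
    obtain i' where i: "i = Suc i'" using \<open>i \<ge> 1\<close> by (cases i) auto
    obtain j' where j: "j = Suc j'" using \<open>j \<ge> 1\<close> by (cases j) auto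
    have "i' * d \<le> j' \<and> j' < Suc i' * d \<longleftrightarrow> j' div d = i'"
      using d less_eq_div_iff_mult_less_eq[of d i' j'] div_less_iff_less_mult[of d j' "Suc i'"] by auto
    then show ?thesis by (auto simp: i j)
  qed
  have block_index: "(j - 1) div d + 1 \<in> {1..s}" if "j \<in> {1..d * s}" for j
  proof -
    have "(j - 1) div d < s" using that d by (subst div_less_iff_less_mult) (auto simp: mult.commute)
    then show ?thesis by simp
  qed
  have block_subset: "?B i \<subseteq> {1..d * s}" if "i \<in> {1..s}" for i
  proof -
    have "i * d \<le> d * s" using that by (simp add: mult.commute)
    then show ?thesis by auto
  qed
  have w_mem: "i \<in> w_set d s u \<longleftrightarrow> i \<in> {1..s} \<and> u \<inter> ?B i \<noteq> {}" for i u
    by (simp add: w_set_def)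
  have fibre: "{u \<in> ?U. w_set d s u = v}
      = {u. u \<subseteq> (\<Union>i\<in>v. ?B i) \<and> (\<forall>i\<in>v. u \<inter> ?B i \<noteq> {})}" if v: "v \<in> ?V" for v
  proof (intro equalityI subsetI)
    fix u assume u: "u \<in> {u \<in> ?U. w_set d s u = v}"
    have "j \<in> (\<Union>i\<in>v. ?B i)" if j: "j \<in> u" for j
    proof -
      have j': "j \<in> {1..d * s}" using u j by auto
      let ?i = "(j - 1) div d + 1"
      have jb: "j \<in> ?B ?i" using j' by (subst in_block) auto
      with j block_index[OF j'] have "?i \<in> w_set d s u" unfolding w_mem by blast
      with u jb show ?thesis by blast
    qed
    moreover have "u \<inter> ?B i \<noteq> {}" if "i \<in> v" for i
      using u that w_mem[of i u] by blast
    ultimately show "u \<in> {u. u \<subseteq> (\<Union>i\<in>v. ?B i) \<and> (\<forall>i\<in>v. u \<inter> ?B i \<noteq> {})}" by blast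
  next
    fix u assume "u \<in> {u. u \<subseteq> (\<Union>i\<in>v. ?B i) \<and> (\<forall>i\<in>v. u \<inter> ?B i \<noteq> {})}"
    then have sub: "u \<subseteq> (\<Union>i\<in>v. ?B i)" and ne: "\<And>i. i \<in> v \<Longrightarrow> u \<inter> ?B i \<noteq> {}" by auto
    have "u \<noteq> {}" using v ne by blast
    moreover have "u \<subseteq> {1..d * s}" using sub v block_subset by blast
    moreover have "w_set d s u = v"
    proof (intro equalityI subsetI)
      fix i assume "i \<in> w_set d s u"
      then obtain j where i: "i \<in> {1..s}" and j: "j \<in> u" "j \<in> ?B i" unfolding w_mem by blast
      obtain l where l: "l \<in> v" "j \<in> ?B l" using sub j by blast
      have "l \<in> {1..s}" using l v by blast
      moreover have "j \<ge> 1" using j by auto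
      ultimately have "i = l" using in_block[of i j] in_block[of l j] i j l by simp
      with l show "i \<in> v" by simp
    next
      fix i assume "i \<in> v"
      then show "i \<in> w_set d s u" unfolding w_mem using ne v by blast
    qed
    ultimately show "u \<in> {u \<in> ?U. w_set d s u = v}" by blast
  qed
  have fibre_sum: "(\<Sum>u | u \<in> ?U \<and> w_set d s u = v. c (w_set d s u) * (\<Prod>j\<in>u. g j)) = c v * H ^ card v"
    if v: "v \<in> ?V" for v
  proof -
    have "(\<Sum>u | u \<in> ?U \<and> w_set d s u = v. c (w_set d s u) * (\<Prod>j\<in>u. g j))
        = c v * (\<Sum>u | u \<in> ?U \<and> w_set d s u = v. \<Prod>j\<in>u. g j)"
      by (simp add: sum_distrib_left)
    also have "(\<Sum>u | u \<in> ?U \<and> w_set d s u = v. \<Prod>j\<in>u. g j) = (\<Prod>i\<in>v. (\<Prod>j\<in>?B i. 1 + g j) - 1)"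
      unfolding fibre[OF v]
    proof (rule sum_subsets_by_blocks)
      show "finite v" using v finite_subset by blast
      show "disjoint_family_on ?B v"
        unfolding disjoint_family_on_def
      proof (intro ballI impI)
        fix i l assume il: "i \<in> v" "l \<in> v" "i \<noteq> l"
        then have "i \<ge> 1" "l \<ge> 1" using v by auto
        show "?B i \<inter> ?B l = {}"
        proof (rule ccontr)
          assume "?B i \<inter> ?B l \<noteq> {}"
          then obtain j where j: "j \<in> ?B i" "j \<in> ?B l" by blast
          then have "j \<ge> 1" by auto
          then show False
            using in_block[of i j] in_block[of l j] \<open>i \<ge> 1\<close> \<open>l \<ge> 1\<close> j il by simp
        qed
      qed
    qed simp
    also have "\<dots> = (\<Prod>i\<in>v. H)"
    proof (rule prod.cong[OF refl])
      fix i assume "i \<in> v"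
      then have i: "i \<in> {1..s}" using v by blast
      then have "i * d = (i - 1) * d + d" by (cases i) auto
      then have "(\<Prod>j\<in>?B i. 1 + g j) = (\<Prod>l = 1..d. 1 + g ((i - 1) * d + l))"
        using prod.shift_bounds_cl_nat_ivl[of "\<lambda>j. 1 + g j" 1 "(i - 1) * d" d]
        by (simp add: add.commute)
      then show "(\<Prod>j\<in>?B i. 1 + g j) - 1 = H" using block[OF i] by simp
    qed
    finally show ?thesis by simp
  qed
  have "w_set d s ` ?U \<subseteq> ?V"
  proof (rule image_subsetI)
    fix u assume u: "u \<in> ?U"
    then obtain j where j: "j \<in> u" by blast
    have j': "j \<in> {1..d * s}" using u j by auto
    have "j \<in> ?B ((j - 1) div d + 1)" using j' by (subst in_block) auto
    then have "(j - 1) div d + 1 \<in> w_set d s u" unfolding w_mem using j block_index[OF j'] by blast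
    then have "w_set d s u \<noteq> {}" by blast
    moreover have "w_set d s u \<subseteq> {1..s}" unfolding w_set_def by blast
    ultimately show "w_set d s u \<in> ?V" by blast
  qed
  then have "(\<Sum>u\<in>?U. c (w_set d s u) * (\<Prod>j\<in>u. g j))
      = (\<Sum>v\<in>?V. \<Sum>u | u \<in> ?U \<and> w_set d s u = v. c (w_set d s u) * (\<Prod>j\<in>u. g j))"
    by (intro sum.group[symmetric]) auto
  also have "\<dots> = (\<Sum>v\<in>?V. c v * H ^ card v)"
    by (rule sum.cong[OF refl fibre_sum])
  finally show ?thesis .
qed

section \<open>The bound for the criterion at its minimizer\<close>

text \<open>Subadditivity is applied twice, to the finite sum over \<open>u\<close> and then to each
  infinite sum over \<open>k\<close>. The summability required for the latter is inherited from the
  sum over all positive vectors.\<close>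

lemma B_crit_powr_le:
  fixes p :: "'a::field poly" and q :: "nat \<Rightarrow> 'a poly"
  assumes "b \<ge> 2" "lam * real d > 1" "lam > 0" "lam \<le> 1"
    and \<gamma>: "\<And>v. v \<subseteq> {1..s} \<Longrightarrow> \<gamma> v \<ge> 0"
  shows "B_crit b m s d \<gamma> q p powr lam \<le>
     (\<Sum>u | u \<noteq> {} \<and> u \<subseteq> {1..d * s}. \<gamma> (w_set d s u) powr lam *
        (\<Sum>\<^sub>\<infinity>k | k \<in> u \<rightarrow>\<^sub>E {1..} \<and> zero_ext (d * s) u k \<in> dual_net b m (d * s) q p.
           r_tilde_prod b d u k powr lam))"
proof -
  let ?U = "{u. u \<noteq> {} \<and> u \<subseteq> {1..d * s}}"
  let ?K = "\<lambda>u. {k. k \<in> u \<rightarrow>\<^sub>E {1..} \<and> zero_ext (d * s) u k \<in> dual_net b m (d * s) q p}"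
  have \<gamma>w: "\<gamma> (w_set d s u) \<ge> 0" for u by (intro \<gamma>) (auto simp: w_set_def)
  have r: "r_tilde_prod b d u k \<ge> 0" for u k
    unfolding r_tilde_prod_def by (intro prod_nonneg r_tilde_nonneg)
  have "B_crit b m s d \<gamma> q p powr lam
      \<le> (\<Sum>u\<in>?U. (\<gamma> (w_set d s u) * (\<Sum>\<^sub>\<infinity>k\<in>?K u. r_tilde_prod b d u k)) powr lam)"
    unfolding B_crit_def
    by (rule sum_powr_le) (use assms \<gamma>w r in \<open>auto intro!: mult_nonneg_nonneg infsum_nonneg\<close>)
  also have "\<dots> = (\<Sum>u\<in>?U. \<gamma> (w_set d s u) powr lam * (\<Sum>\<^sub>\<infinity>k\<in>?K u. r_tilde_prod b d u k) powr lam)"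
    by (intro sum.cong refl powr_mult)
  also have "\<dots> \<le> (\<Sum>u\<in>?U. \<gamma> (w_set d s u) powr lam * (\<Sum>\<^sub>\<infinity>k\<in>?K u. r_tilde_prod b d u k powr lam))"
  proof (intro sum_mono mult_left_mono infsum_powr_le r assms(3,4))
    fix u assume "u \<in> ?U"
    then have finu: "finite u" using finite_subset by blast
    have "((\<lambda>k. r_tilde_prod b d u k powr lam) has_sum (\<Prod>j\<in>u. r_tilde_powr_sum b d lam j)) (u \<rightarrow>\<^sub>E {1..})"
      unfolding r_tilde_prod_powr[OF finu]
      by (rule has_sum_prod_PiE_nonneg[OF finu]) (use has_sum_r_tilde_powr[OF assms(1,2)] in auto)
    then show "(\<lambda>k. r_tilde_prod b d u k powr lam) summable_on ?K u"
      by (rule summable_on_subset_banach[OF has_sum_imp_summable]) auto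
  qed auto
  finally show ?thesis .
qed

theorem theorem7:
  fixes b s m \<alpha> d :: nat
    and \<gamma> :: "nat set \<Rightarrow> real"
    and p q :: "'a::field poly"
    and lam :: real
  assumes "prime b" and "CARD('a) = b"
    and "s \<ge> 1" and "m \<ge> 1" and "1 < d" and "d \<le> \<alpha>"
    and "\<And>v. v \<subseteq> {1..s} \<Longrightarrow> \<gamma> v \<ge> 0"
    and "irreducible p" and "degree p = m"
    and "q \<in> R_polys m"
    and "\<And>q'. q' \<in> R_polys m \<Longrightarrow> B_crit b m s d \<gamma> (psi p q) p \<le> B_crit b m s d \<gamma> (psi p q') p"
    and "1 / real (min \<alpha> d) < lam" and "lam \<le> 1"
  shows "B_crit b m s d \<gamma> (psi p q) p
    \<le> real (d * s) powr (1 / lam) / (real b ^ m - 1) powr (1 / lam) *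
      (\<Sum>v | v \<noteq> {} \<and> v \<subseteq> {1..s}. \<gamma> v powr lam * H_const b \<alpha> d lam ^ card v) powr (1 / lam)"
proof -
  let ?U = "{u. u \<noteq> {} \<and> u \<subseteq> {1..d * s}}"
  let ?V = "{v. v \<noteq> {} \<and> v \<subseteq> {1..s}}"
  let ?B = "B_crit b m s d \<gamma> (psi p q) p"
  let ?T = "\<lambda>q' u. \<Sum>\<^sub>\<infinity>k | k \<in> u \<rightarrow>\<^sub>E {1..} \<and> zero_ext (d * s) u k \<in> dual_net b m (d * s) (psi p q') p.
      r_tilde_prod b d u k powr lam"
  let ?G = "r_tilde_powr_sum b d lam"
  let ?H = "H_const b \<alpha> d lam"
  let ?S = "\<Sum>v\<in>?V. \<gamma> v powr lam * ?H ^ card v"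
  have b: "b \<ge> 2" using assms(1) by (rule prime_ge_2_nat)
  have min: "min \<alpha> d = d" using assms(6) by simp
  have lam_d: "lam * real d > 1"
    using assms(5,12) by (simp add: min divide_less_eq)
  have lam: "lam > 0"
    using assms(12) by (rule le_less_trans[rotated]) simp
  have \<gamma>w: "\<gamma> (w_set d s u) \<ge> 0" for u by (intro assms(7)) (auto simp: w_set_def)
  have B0: "?B \<ge> 0"
    unfolding B_crit_def r_tilde_prod_def
    by (intro sum_nonneg mult_nonneg_nonneg \<gamma>w infsum_nonneg prod_nonneg r_tilde_nonneg)
  have finUNIV: "finite (UNIV :: 'a set)"
    using assms(2) b by (metis card.infinite not_numeral_le_zero)
  have N: "real (card (R_polys m :: 'a poly set)) = real b ^ m - 1"
    using card_R_polys(2)[OF assms(4) finUNIV] assms(2) b by (simp add: of_nat_diff)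
  have "1 < real b ^ m" using b assms(4) by (intro one_less_power) auto
  then have N_pos: "real b ^ m - 1 > 0" by simp
  \<comment> \<open>The averaging takes place on \<open>lam\<close>-th powers, cleared of the
    denominator: the minimal value is counted once for every candidate.\<close>
  have "(real b ^ m - 1) * ?B powr lam = (\<Sum>q'\<in>(R_polys m :: 'a poly set). ?B powr lam)"
    by (simp flip: N)
  also have "\<dots> \<le> (\<Sum>q'\<in>R_polys m. B_crit b m s d \<gamma> (psi p q') p powr lam)"
    using lam B0 assms(11) by (intro sum_mono powr_mono2) auto
  also have "\<dots> \<le> (\<Sum>q'\<in>R_polys m. \<Sum>u\<in>?U. \<gamma> (w_set d s u) powr lam * ?T q' u)"
    using b assms(5,7,13) lam lam_d by (intro sum_mono B_crit_powr_le) auto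
  also have "\<dots> = (\<Sum>u\<in>?U. \<gamma> (w_set d s u) powr lam * (\<Sum>q'\<in>R_polys m. ?T q' u))"
    by (subst sum.swap) (simp add: sum_distrib_left)
  also have "\<dots> \<le> (\<Sum>u\<in>?U. \<gamma> (w_set d s u) powr lam * (real (d * s) * (\<Prod>j\<in>u. ?G j)))"
    using assms(1,2,4,8,9) lam_d by (intro sum_mono mult_left_mono sum_dual_korobov_le) auto
  also have "\<dots> = real (d * s) * (\<Sum>u\<in>?U. \<gamma> (w_set d s u) powr lam * (\<Prod>j\<in>u. ?G j))"
    by (simp add: sum_distrib_left mult_ac)
  \<comment> \<open>The only dependence on \<open>u\<close> besides the product is through
    \<open>w_set\<close>, so the regrouping applies with the \<open>lam\<close>-th powers of the
    weights as coefficients.\<close>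
  also have "(\<Sum>u\<in>?U. \<gamma> (w_set d s u) powr lam * (\<Prod>j\<in>u. ?G j)) = ?S"
  proof (rule sum_by_w_set[where c = "\<lambda>v. \<gamma> v powr lam"])
    fix i assume "i \<in> {1..s}"
    then have "(\<Prod>l = 1..d. 1 + ?G ((i - 1) * d + l))
        = (\<Prod>l = 1..d. 1 + real b powr (lam * (real d - real l)) * H_tilde b \<alpha> d lam)"
      using assms(5) by (intro prod.cong refl) (subst r_tilde_powr_sum_block, auto simp: H_tilde_def min)
    then show "(\<Prod>l = 1..d. 1 + ?G ((i - 1) * d + l)) - 1 = ?H"
      by (simp add: H_const_def)
  qed (use assms(5) in simp)
  finally have main: "?B powr lam \<le> real (d * s) / (real b ^ m - 1) * ?S"
    using N_pos by (simp add: field_simps)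
  have H: "?H \<ge> 0"
  proof -
    have "H_tilde b \<alpha> d lam \<ge> 0"
      using powr_lam_d_gt[OF b lam_d] b by (simp add: H_tilde_def min)
    then show ?thesis unfolding H_const_def by (simp add: prod_ge_1)
  qed
  have S0: "?S \<ge> 0" by (intro sum_nonneg mult_nonneg_nonneg zero_le_power H) auto
  have "?B = (?B powr lam) powr (1 / lam)" using B0 lam by (simp add: powr_powr)
  also have "\<dots> \<le> (real (d * s) / (real b ^ m - 1) * ?S) powr (1 / lam)"
    using main lam by (intro powr_mono2) auto
  also have "\<dots> = real (d * s) powr (1 / lam) / (real b ^ m - 1) powr (1 / lam) * ?S powr (1 / lam)"
    using N_pos S0 by (simp add: powr_mult powr_divide)
  finally show ?thesis .
qed

end
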